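(* For $n\ge1$ and integer $k$, let $J^{\overline{B}}_{2n,k}$ be the number of fixed-point free signed involutions $\pi\in\mathfrak{B}_{2n}$ (i.e. $\pi^{-1}=\pi$ and $\pi_i\ne\pm i$ for all $i$) with $\operatorname{des}^B(\pi)=k$ (so $J^{\overline{B}}_{2n,k}=0$ if $k<0$). Then $J^{\overline{B}}_{2,0}=0$, $J^{\overline{B}}_{2,1}=2$, $J^{\overline{B}}_{2,2}=0$, and for all $n\ge2$, $k\ge0$, \[ \begin{aligned} nJ^{\overline{B}}_{2n,k}={}&(k^2+k+n-1)J^{\overline{B}}_{2n-2,k}+2\big((k-1)(2n-k-1)+n\big)J^{\overline{B}}_{2n-2,k-1}\\ &+\big((2n-k)(2n-k+1)+(n-1)\big)J^{\overline{B}}_{2n-2,k-2}. \end{aligned} \]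
   Context: $\mathfrak{B}_m$ is the set of signed permutations $\pi=\pi_1\cdots\pi_m$ ($\pi_i\in\{\pm1,\dots,\pm m\}$, $|\pi_1|,\dots,|\pi_m|$ a permutation of $[m]$), with $\pi_0=0$; the inverse is defined by $\pi^{-1}_{|\pi_i|}=\operatorname{sgn}(\pi_i)\,i$. With the natural order on $\mathbb{Z}$, $\operatorname{des}^B(\pi)=|\{i\in\{0,\dots,m-1\}:\pi_i>\pi_{i+1}\}|$. *)

theory Defs
  imports Main
begin

(* A signed permutation of [m] is encoded as a function on all of nat, with entries at
   positions 1..m and value 0 elsewhere: this makes the encoding of words unique, and the
   value at position 0 is the convention pi_0 = 0. *)
definition signed_perms :: "nat \<Rightarrow> (nat \<Rightarrow> int) set" where
  "signed_perms m =
     {\<pi>. bij_betw (\<lambda>i. nat \<bar>\<pi> i\<bar>) {1..m} {1..m} \<and> (\<forall>i. i \<notin> {1..m} \<longrightarrow> \<pi> i = 0)}"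

(* The position i with |pi_i| = j is recovered by inv_into; see signed_inverse_abs below. *)
definition signed_inverse :: "nat \<Rightarrow> (nat \<Rightarrow> int) \<Rightarrow> (nat \<Rightarrow> int)" where
  "signed_inverse m \<pi> =
     (\<lambda>j. if j \<in> {1..m}
          then let i = inv_into {1..m} (\<lambda>i. nat \<bar>\<pi> i\<bar>) j in sgn (\<pi> i) * int i
          else 0)"

lemma signed_inverse_abs:
  assumes "\<pi> \<in> signed_perms m" and "i \<in> {1..m}"
  shows "signed_inverse m \<pi> (nat \<bar>\<pi> i\<bar>) = sgn (\<pi> i) * int i"
proof -
  have bij: "bij_betw (\<lambda>i. nat \<bar>\<pi> i\<bar>) {1..m} {1..m}"
    using assms(1) by (simp add: signed_perms_def)
  have "nat \<bar>\<pi> i\<bar> \<in> {1..m}"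
    using bij_betwE[OF bij] assms(2) by blast
  moreover have "inv_into {1..m} (\<lambda>i. nat \<bar>\<pi> i\<bar>) (nat \<bar>\<pi> i\<bar>) = i"
    using bij_betw_inv_into_left[OF bij assms(2)] .
  ultimately show ?thesis
    by (simp only: signed_inverse_def Let_def if_True)
qed

definition des_B :: "nat \<Rightarrow> (nat \<Rightarrow> int) \<Rightarrow> nat" where
  "des_B m \<pi> = card {i \<in> {0..<m}. \<pi> i > \<pi> (i + 1)}"

definition signed_involution :: "nat \<Rightarrow> (nat \<Rightarrow> int) \<Rightarrow> bool" where
  "signed_involution m \<pi> \<longleftrightarrow> \<pi> \<in> signed_perms m \<and> signed_inverse m \<pi> = \<pi>"

definition fixed_point_free :: "nat \<Rightarrow> (nat \<Rightarrow> int) \<Rightarrow> bool" where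
  "fixed_point_free m \<pi> \<longleftrightarrow> (\<forall>i\<in>{1..m}. \<pi> i \<noteq> int i \<and> \<pi> i \<noteq> - int i)"

definition J_B :: "nat \<Rightarrow> int \<Rightarrow> nat" where
  "J_B m k =
     card {\<pi>. signed_involution m \<pi> \<and> fixed_point_free m \<pi> \<and> int (des_B m \<pi>) = k}"

lemma finite_signed_perms: "finite (signed_perms m)"
proof (rule finite_subset)
  let ?B = "{- int m..int m}"
  show "finite {\<pi>. \<forall>i. (i \<in> {1..m} \<longrightarrow> \<pi> i \<in> ?B) \<and> (i \<notin> {1..m} \<longrightarrow> \<pi> i = (0::int))}"
    by (rule finite_set_of_finite_funs) simp_all
  show "signed_perms m \<subseteq>
      {\<pi>. \<forall>i. (i \<in> {1..m} \<longrightarrow> \<pi> i \<in> ?B) \<and> (i \<notin> {1..m} \<longrightarrow> \<pi> i = (0::int))}"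
  proof (rule subsetI, rule CollectI, rule allI)
    fix \<pi> i assume pi: "\<pi> \<in> signed_perms m"
    have "nat \<bar>\<pi> i\<bar> \<in> {1..m}" if "i \<in> {1..m}"
      using pi that bij_betwE[of "\<lambda>i. nat \<bar>\<pi> i\<bar>" "{1..m}" "{1..m}"]
      unfolding signed_perms_def by blast
    then have "\<pi> i \<in> ?B" if "i \<in> {1..m}"
      using that by fastforce
    then show "(i \<in> {1..m} \<longrightarrow> \<pi> i \<in> ?B) \<and> (i \<notin> {1..m} \<longrightarrow> \<pi> i = 0)"
      using pi by (simp add: signed_perms_def)
  qed
qed

end

theory Submission
  imports Defs "HOL-Library.Multiset" "HOL-Library.Product_Lexorder"
begin

text \<open>
  Let \<open>m = 2 n\<close>. The recurrence is equivalent to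
  \<open>(\<Sum>k\<le>r. J m k * (m + r - k choose m)) = (r * (r + 1) + n - 1 choose n)\<close> for all \<open>r\<close>,
  because the right-hand side \<open>A n r\<close> satisfies \<open>n * A n r = (r * (r + 1) + n - 1) * A (n - 1) r\<close> and the
  linear system in the \<open>J\<close> is unitriangular. The left-hand side counts pairs \<open>(\<pi>, a)\<close> where
  \<open>0 = a 0 \<le> a 1 \<le> \<dots> \<le> a m \<le> r\<close> increases strictly at the descents of \<open>\<pi>\<close>. Extend \<open>\<pi>\<close> and
  \<open>a\<close> to odd functions \<open>w\<close>, \<open>g\<close> on \<open>{- m..m}\<close>; the condition becomes that \<open>i \<mapsto> (g i, w i)\<close> is
  strictly lexicographically increasing. Then \<open>p i = (g i, g (w i))\<close> is weakly increasing, hence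
  determined by its multiset of values, and \<open>w\<close> is the unique increasing bijection from each fibre
  \<open>p = (x, y)\<close> onto the fibre \<open>p = (y, x)\<close>. The multiset is invariant under swapping and negating;
  fixed-point freeness says that its diagonal is trivial and that its antidiagonal
  multiplicities are even. So it amounts to an arbitrary multiset of \<open>n\<close> cells \<open>(x, y)\<close>
  with \<open>1 \<le> x \<le> r\<close> and \<open>- x \<le> y < x\<close>, of which there are \<open>r * (r + 1)\<close>.
\<close>

section \<open>Ranks and sorted functions\<close>

definition rank :: "'a::linorder set \<Rightarrow> 'a \<Rightarrow> nat" where
  "rank F x = card {y \<in> F. y < x}"

lemma rank_strict_mono:
  assumes "finite F" "x \<in> F" "x < y"
  shows "rank F x < rank F y"
  unfolding rank_def by (rule psubset_card_mono) (use assms in auto)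

lemma rank_eq_iff:
  assumes "finite F" "x \<in> F" "y \<in> F"
  shows "rank F x = rank F y \<longleftrightarrow> x = y"
  using rank_strict_mono[OF assms(1)] assms by (metis linorder_neqE less_irrefl)

lemma bij_betw_rank:
  assumes "finite F"
  shows "bij_betw (rank F) F {..<card F}"
proof -
  have inj: "inj_on (rank F) F"
    using rank_eq_iff[OF assms] by (auto intro: inj_onI)
  have "rank F ` F \<subseteq> {..<card F}"
    by (auto simp: rank_def intro!: psubset_card_mono assms)
  then have "rank F ` F = {..<card F}"
    by (rule card_subset_eq[rotated]) (use card_image[OF inj] in auto)
  then show ?thesis
    using inj by (simp add: bij_betw_def)
qed

text \<open>Negation reverses the order, so the first rank counts the elements of \<open>F\<close>
  above \<open>x\<close>; together with those below \<open>x\<close> and \<open>x\<close> itself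
  they exhaust \<open>F\<close>.\<close>

lemma rank_uminus:
  fixes F :: "int set"
  assumes "finite F" "x \<in> F"
  shows "rank (uminus ` F) (- x) + rank F x + 1 = card F"
proof -
  have "{y \<in> uminus ` F. y < - x} = uminus ` {y \<in> F. x < y}"
    by auto
  then have "rank (uminus ` F) (- x) = card {y \<in> F. x < y}"
    by (simp add: rank_def card_image)
  moreover have "card F = card ({y \<in> F. x < y} \<union> ({y \<in> F. y < x} \<union> {x}))"
    by (rule arg_cong[where f = card]) (use assms in auto)
  moreover have "card ({y \<in> F. x < y} \<union> ({y \<in> F. y < x} \<union> {x}))
      = card {y \<in> F. x < y} + card ({y \<in> F. y < x} \<union> {x})"
    by (rule card_Un_disjoint) (use assms in auto)
  moreover have "card ({y \<in> F. y < x} \<union> {x}) = card {y \<in> F. y < x} + card {x}"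
    by (rule card_Un_disjoint) (use assms in auto)
  ultimately show ?thesis
    by (simp add: rank_def)
qed

text \<open>An increasing bijection carries the elements below \<open>x\<close> onto those below
  \<open>f x\<close>.\<close>

lemma rank_bij_betw:
  assumes "bij_betw f F G" "strict_mono_on F f" "x \<in> F"
  shows "rank G (f x) = rank F x"
proof -
  have "{y \<in> G. y < f x} = f ` {y \<in> F. y < x}"
    using assms by (auto simp: bij_betw_def strict_mono_on_less)
  moreover have "inj_on f {y \<in> F. y < x}"
    using assms(1) by (auto simp: bij_betw_def inj_on_def)
  ultimately show ?thesis
    by (simp add: rank_def card_image)
qed

text \<open>The values listed in order of position form a sorted list, and a sorted list is
  determined by its multiset.\<close>

lemma mono_on_unique:
  fixes p q :: "int \<Rightarrow> 'a::linorder"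
  assumes "mono_on {a..b} p" "mono_on {a..b} q"
    and "image_mset p (mset_set {a..b}) = image_mset q (mset_set {a..b})"
    and "i \<in> {a..b}"
  shows "p i = q i"
proof -
  have sorted: "sorted (map f [a..b])" if "mono_on {a..b} f" for f :: "int \<Rightarrow> 'a"
    by (rule sorted_map_mono) (use that in auto)
  have ms: "mset (map f [a..b]) = image_mset f (mset_set {a..b})" for f :: "int \<Rightarrow> 'a"
    by (simp add: mset_set_set[symmetric])
  have "map p [a..b] = map q [a..b]"
    using sorted[OF assms(1)] sorted[OF assms(2)] ms assms(3)
    by (metis properties_for_sort)
  then show ?thesis
    using assms(4) by simp
qed

lemma count_image_mset_involution:
  assumes "\<And>z. f (f z) = z"
  shows "count (image_mset f C) z = count C (f z)"
proof -
  have "count (image_mset f C) z = (\<Sum>y\<in>{f z} \<inter> set_mset C. count C y)"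
    unfolding count_image_mset by (rule sum.cong) (use assms in auto)
  then show ?thesis
    by (cases "f z \<in># C") (auto simp: not_in_iff)
qed

section \<open>Multisets of cells\<close>

text \<open>An antidiagonal cell \<open>(x, - x)\<close> is fixed by one of the three reflections, so a copy of it
  in \<open>C\<close> contributes two copies of \<open>(x, - x)\<close> and of \<open>(- x, x)\<close> each.\<close>

definition symmetrize :: "(int \<times> int) multiset \<Rightarrow> (int \<times> int) multiset" where
  "symmetrize C = {#(0, 0)#} + C + image_mset (\<lambda>(x, y). (y, x)) C
     + image_mset (\<lambda>(x, y). (- x, - y)) C + image_mset (\<lambda>(x, y). (- y, - x)) C"

text \<open>A fundamental domain: each orbit of off-diagonal pairs with coordinates in
  \<open>{- r..r}\<close> under swapping and negating contains exactly one cell.\<close>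

definition cells :: "nat \<Rightarrow> (int \<times> int) set" where
  "cells r = (SIGMA x:{1..int r}. {- x..<x})"

lemma mem_cells: "(x, y) \<in> cells r \<longleftrightarrow> 1 \<le> x \<and> x \<le> int r \<and> - x \<le> y \<and> y < x"
  by (auto simp: cells_def)

lemma finite_cells: "finite (cells r)"
  by (simp add: cells_def)

lemma card_cells: "card (cells r) = r * (r + 1)"
proof (induction r)
  case (Suc r)
  have "cells (Suc r) = cells r \<union> {int (Suc r)} \<times> {- int (Suc r)..<int (Suc r)}"
    by (auto simp: cells_def)
  moreover have "cells r \<inter> {int (Suc r)} \<times> {- int (Suc r)..<int (Suc r)} = {}"
    by (auto simp: cells_def)
  ultimately have "card (cells (Suc r))
      = card (cells r) + card ({int (Suc r)} \<times> {- int (Suc r)..<int (Suc r)})"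
    by (simp only: card_Un_disjoint finite_cells finite_cartesian_product
        finite_atLeastLessThan_int finite.emptyI finite.insertI)
  then show ?case
    using Suc by (simp add: card_cartesian_product)
qed (simp add: cells_def)

lemma count_symmetrize:
  "count (symmetrize C) (x, y) = of_bool (x = 0 \<and> y = 0) + count C (x, y) + count C (y, x)
     + count C (- x, - y) + count C (- y, - x)"
  by (simp add: symmetrize_def count_image_mset_involution split_beta)

lemma size_symmetrize: "size (symmetrize C) = 4 * size C + 1"
  by (simp add: symmetrize_def)

text \<open>Different cells are never related by a reflection, so only the cell itself contributes,
  once more if the antidiagonal reflection fixes it. Hence \<open>C\<close> can be read off
  \<open>symmetrize C\<close>.\<close>

lemma count_symmetrize_cells:
  assumes "set_mset C \<subseteq> cells r" "(x, y) \<in> cells r"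
  shows "count (symmetrize C) (x, y) = (if y = - x then 2 else 1) * count C (x, y)"
proof -
  have out: "count C v = 0" if "v \<notin> cells r" for v
    using that assms(1) by (auto simp: count_eq_zero_iff)
  have "count C (y, x) = 0" "count C (- x, - y) = 0"
    using assms(2) by (auto intro!: out simp: mem_cells)
  moreover have "count C (- y, - x) = (if y = - x then count C (x, y) else 0)"
    using assms(2) by (auto intro!: out simp: mem_cells)
  ultimately show ?thesis
    using assms(2) by (auto simp: count_symmetrize mem_cells)
qed

lemma symmetrize_inject:
  assumes "set_mset C \<subseteq> cells r" "set_mset D \<subseteq> cells r" "symmetrize C = symmetrize D"
  shows "C = D"
proof (rule multiset_eqI)
  fix v :: "int \<times> int"
  show "count C v = count D v"
  proof (cases "v \<in> cells r")
    case True
    obtain x y where v: "v = (x, y)"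
      by (cases v)
    show ?thesis
      using count_symmetrize_cells[OF assms(1), of x y] count_symmetrize_cells[OF assms(2), of x y]
        assms(3) True
      by (auto simp: v split: if_splits)
  next
    case False
    then show ?thesis
      using assms(1,2) by (metis count_eq_zero_iff subsetD)
  qed
qed

section \<open>From matched pairs to multisets\<close>

definition matched_pair :: "nat \<Rightarrow> nat \<Rightarrow> (int \<Rightarrow> int) \<Rightarrow> (int \<Rightarrow> int) \<Rightarrow> bool" where
  "matched_pair m r w g \<longleftrightarrow>
     (\<forall>i. w (- i) = - w i) \<and> (\<forall>i. g (- i) = - g i) \<and>
     (\<forall>i. \<bar>i\<bar> > int m \<longrightarrow> w i = 0 \<and> g i = 0) \<and>
     (\<forall>i. \<bar>i\<bar> \<le> int m \<longrightarrow> \<bar>w i\<bar> \<le> int m \<and> w (w i) = i \<and> \<bar>g i\<bar> \<le> int r) \<and>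
     (\<forall>i. i \<noteq> 0 \<longrightarrow> \<bar>i\<bar> \<le> int m \<longrightarrow> \<bar>w i\<bar> \<noteq> \<bar>i\<bar>) \<and>
     strict_mono_on {- int m..int m} (\<lambda>i. (g i, w i))"

text \<open>For \<open>i \<noteq> 0\<close> the orbit \<open>{i, w i, - i, - w i}\<close> has four elements; the closers are the
  largest elements of these orbits.\<close>

definition closers :: "nat \<Rightarrow> (int \<Rightarrow> int) \<Rightarrow> int set" where
  "closers m w = {i \<in> {1..int m}. \<bar>w i\<bar> < i}"

text \<open>One cell is recorded per orbit; the positions \<open>w i\<close>, \<open>- i\<close> and
  \<open>- w i\<close> would give its three reflected copies, which \<open>symmetrize\<close>
  restores.\<close>

definition cell_mset :: "nat \<Rightarrow> (int \<Rightarrow> int) \<times> (int \<Rightarrow> int) \<Rightarrow> (int \<times> int) multiset" where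
  "cell_mset m = (\<lambda>(w, g). image_mset (\<lambda>i. (g i, g (w i))) (mset_set (closers m w)))"

section \<open>Structure of a fixed matched pair\<close>

context
  fixes m r w g
  assumes mp: "matched_pair m r w g"
begin

lemma w_odd: "w (- i) = - w i"
  and g_odd: "g (- i) = - g i"
  and matched_pair_outside: "\<bar>i\<bar> > int m \<Longrightarrow> w i = 0 \<and> g i = 0"
  and w_range: "\<bar>i\<bar> \<le> int m \<Longrightarrow> \<bar>w i\<bar> \<le> int m"
  and w_invol: "\<bar>i\<bar> \<le> int m \<Longrightarrow> w (w i) = i"
  and w_free: "i \<noteq> 0 \<Longrightarrow> \<bar>i\<bar> \<le> int m \<Longrightarrow> \<bar>w i\<bar> \<noteq> \<bar>i\<bar>"
  using mp by (simp_all add: matched_pair_def)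

lemma g_range: "\<bar>g i\<bar> \<le> int r"
  using mp by (cases "\<bar>i\<bar> \<le> int m") (simp_all add: matched_pair_def)

lemma lex_less:
  assumes "- int m \<le> i" "i < j" "j \<le> int m"
  shows "g i < g j \<or> g i = g j \<and> w i < w j"
proof -
  have "strict_mono_on {- int m..int m} (\<lambda>i. (g i, w i))"
    using mp by (simp add: matched_pair_def)
  then have "(g i, w i) < (g j, w j)"
    using assms by (auto simp: strict_mono_on_def)
  then show ?thesis
    by auto
qed

lemma g_mono:
  assumes "- int m \<le> i" "i \<le> j" "j \<le> int m"
  shows "g i \<le> g j"
  using lex_less[of i j] assms by (cases "i = j") auto

text \<open>When \<open>g\<close> ties at \<open>i < j\<close>, the lexicographic condition gives
  \<open>w i < w j\<close>, and monotonicity of \<open>g\<close> orders the second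
  coordinates.\<close>

lemma mono_on_cell: "mono_on {- int m..int m} (\<lambda>i. (g i, g (w i)))"
proof (rule mono_onI)
  fix i j assume ij: "i \<in> {- int m..int m}" "j \<in> {- int m..int m}" "i \<le> j"
  show "(g i, g (w i)) \<le> (g j, g (w j))"
  proof (cases "i = j")
    case False
    then have "g i < g j \<or> g i = g j \<and> w i < w j"
      using ij lex_less[of i j] by auto
    moreover have "g (w i) \<le> g (w j)" if "w i < w j"
      using that w_range[of i] w_range[of j] ij by (intro g_mono) (auto simp: abs_le_iff)
    ultimately show ?thesis
      by auto
  qed simp
qed

lemma closers_subset: "closers m w \<subseteq> {- int m..int m}"
  by (auto simp: closers_def)

lemma finite_closers: "finite (closers m w)"
  using closers_subset finite_subset by blast

text \<open>Since \<open>w\<close> has no fixed points up to sign, each nonzero orbit has exactly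
  one closer: the positive element of largest absolute value.\<close>

lemma positions_eq:
  "mset_set {- int m..int m} = {#0#} + mset_set (closers m w)
     + image_mset w (mset_set (closers m w)) + image_mset uminus (mset_set (closers m w))
     + image_mset (\<lambda>i. - w i) (mset_set (closers m w))"
proof -
  let ?I = "closers m w"
  have w0: "w 0 = 0"
    using w_odd[of 0] by simp
  have I: "1 \<le> i \<and> i \<le> int m \<and> \<bar>w i\<bar> < i \<and> w (w i) = i \<and> w i \<noteq> 0" if "i \<in> ?I" for i
    using that w_invol[of i] w0 by (auto simp: closers_def)
  have ww: "w (- w i) = - i" if "i \<in> ?I" for i
    using I[OF that] w_odd by simp
  have inj: "inj_on w ?I" "inj_on (\<lambda>i. - w i) ?I"
    using I ww by (auto intro: inj_on_inverseI[where g = w] inj_on_inverseI[where g = "\<lambda>j. - w j"]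
      simp: w_odd)
  \<comment> \<open>Each of the first two equalities would make \<open>w\<close> exchange
    \<open>i\<close> and \<open>j\<close> up to sign, so that each is smaller than the other; the
    third forces \<open>i = - j\<close> although both are positive.\<close>
  have less: "w i \<noteq> j" "w i \<noteq> - j" "w i \<noteq> - w j" if "i \<in> ?I" "j \<in> ?I" for i j
  proof -
    have "w (w i) = i"
      using I[OF that(1)] by simp
    then have "w i = j \<Longrightarrow> i = w j" "w i = - j \<Longrightarrow> i = - w j" "w i = - w j \<Longrightarrow> i = - j"
      using ww[OF that(2)] w_odd[of j] by simp_all
    then show "w i \<noteq> j" "w i \<noteq> - j" "w i \<noteq> - w j"
      using I[OF that(1)] I[OF that(2)] by (smt (verit))+
  qed
  have union: "{- int m..int m} = {0} \<union> ?I \<union> w ` ?I \<union> uminus ` ?I \<union> (\<lambda>i. - w i) ` ?I"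
  proof (intro equalityI subsetI)
    fix j assume j: "j \<in> {- int m..int m}"
    have invol: "w (w j) = j" and odd: "w (- j) = - w j" "w (- w j) = - w (w j)"
      using w_invol[of j] j w_odd[of j] w_odd[of "w j"] by (simp_all add: abs_le_iff minus_le_iff)
    then have cov: "j = w (w j)" "j = - w (- w j)" "j = - (- j)"
      by simp_all
    have "\<bar>j\<bar> \<le> int m"
      using j by auto
    then have "\<bar>w j\<bar> \<le> int m" "j \<noteq> 0 \<Longrightarrow> \<bar>w j\<bar> \<noteq> \<bar>j\<bar>"
      using w_free[of j] w_range[of j] by blast+
    then have "j = 0 \<or> j \<in> ?I \<or> - j \<in> ?I \<or> w j \<in> ?I \<or> - w j \<in> ?I"
      using j unfolding closers_def mem_Collect_eq odd invol by auto
    then show "j \<in> {0} \<union> ?I \<union> w ` ?I \<union> uminus ` ?I \<union> (\<lambda>i. - w i) ` ?I"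
      using cov by blast
  next
    fix j assume j: "j \<in> {0} \<union> ?I \<union> w ` ?I \<union> uminus ` ?I \<union> (\<lambda>i. - w i) ` ?I"
    have "\<bar>i\<bar> \<le> int m" "\<bar>w i\<bar> \<le> int m" if "i \<in> ?I" for i
      using that by (auto simp: closers_def)
    then have "\<bar>j\<bar> \<le> int m"
      using j by (elim UnE imageE) auto
    then show "j \<in> {- int m..int m}"
      by auto
  qed
  have pos: "0 < i" "w i \<noteq> 0" if "i \<in> ?I" for i
    using I[OF that] by auto
  have disj1: "{0} \<inter> ?I = {}"
    using pos by blast
  have disj2: "({0} \<union> ?I) \<inter> w ` ?I = {}"
    using pos less(1) by fastforce
  have disj3: "({0} \<union> ?I \<union> w ` ?I) \<inter> uminus ` ?I = {}"
  proof -
    have "0 \<noteq> - j \<and> i \<noteq> - j \<and> w i \<noteq> - j" if "i \<in> ?I" "j \<in> ?I" for i j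
      using less(2)[OF that] pos(1)[OF that(1)] pos(1)[OF that(2)] by auto
    then show ?thesis
      by blast
  qed
  have disj4: "({0} \<union> ?I \<union> w ` ?I \<union> uminus ` ?I) \<inter> (\<lambda>i. - w i) ` ?I = {}"
  proof -
    have "w i \<noteq> - w j \<and> - i \<noteq> - w j \<and> i \<noteq> - w j \<and> 0 \<noteq> - w j" if "i \<in> ?I" "j \<in> ?I" for i j
      using less[OF that] less[OF that(2) that(1)] pos(2)[OF that(2)] by auto
    then show ?thesis
      by blast
  qed
  show ?thesis
    unfolding union
    by (simp only: mset_set_Union[OF _ _ disj1] mset_set_Union[OF _ _ disj2]
        mset_set_Union[OF _ _ disj3] mset_set_Union[OF _ _ disj4] finite_closers finite_UnI
        finite_imageI finite.emptyI finite.insertI image_mset_mset_set[OF inj(1)]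
        image_mset_mset_set[OF inj(2)] image_mset_mset_set[of uminus] inj_uminus
        inj_on_subset[OF inj_uminus subset_UNIV] mset_set.insert
        mset_set.empty empty_iff not_False_eq_True)
qed

text \<open>The five summands of \<open>positions_eq\<close> map to the five summands of
  \<open>symmetrize\<close>, by oddness of \<open>w\<close> and \<open>g\<close> and
  \<open>w (w i) = i\<close>.\<close>

lemma symmetrize_cell_mset:
  "symmetrize (cell_mset m (w, g)) = image_mset (\<lambda>i. (g i, g (w i))) (mset_set {- int m..int m})"
proof -
  have "w 0 = 0" "g 0 = 0"
    using w_odd[of 0] g_odd[of 0] by simp_all
  moreover have "w (w i) = i" if "i \<in> closers m w" for i
    using that by (intro w_invol) (auto simp: closers_def)
  ultimately show ?thesis
    unfolding positions_eq using finite_closers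
    by (auto simp: symmetrize_def cell_mset_def multiset.map_comp comp_def w_odd g_odd
        intro!: arg_cong2[where f = plus] image_mset_cong)
qed

lemma size_cell_mset: "4 * size (cell_mset m (w, g)) = 2 * m"
  using arg_cong[OF symmetrize_cell_mset, of size] by (simp add: size_symmetrize)

text \<open>If \<open>g i = g (w i)\<close> with \<open>w i < i\<close>, the lexicographic condition at
  \<open>(w i, i)\<close> reads \<open>i < w i\<close>; so the diagonal is never hit.\<close>

lemma cell_mset_subset: "set_mset (cell_mset m (w, g)) \<subseteq> cells r"
proof -
  have "(g i, g (w i)) \<in> cells r" if "i \<in> closers m w" for i
  proof -
    have i: "1 \<le> i" "i \<le> int m" "\<bar>w i\<bar> < i"
      using that by (auto simp: closers_def)
    have "w (w i) = i"
      using i by (intro w_invol) auto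
    then have "g (w i) < g i"
      using lex_less[of "w i" i] i by auto
    moreover have "g (- w i) \<le> g i"
      using i by (intro g_mono) auto
    ultimately show ?thesis
      using g_range[of i] by (auto simp: mem_cells g_odd)
  qed
  then show ?thesis
    using finite_closers by (auto simp: cell_mset_def)
qed

text \<open>As an involution \<open>w\<close> exchanges the two fibres, and it increases on each
  because \<open>g\<close> is constant there. So the fibres determine \<open>w\<close>.\<close>

lemma rank_w:
  defines "F \<equiv> \<lambda>x y. {j \<in> {- int m..int m}. g j = x \<and> g (w j) = y}"
  assumes "i \<in> F x y"
  shows "rank (F y x) (w i) = rank (F x y) i"
proof (rule rank_bij_betw)
  have mem: "w i \<in> F y x" "w (w i) = i" if "i \<in> F x y" for i x y
  proof -
    have i: "\<bar>i\<bar> \<le> int m" "g i = x" "g (w i) = y"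
      using that by (auto simp: F_def)
    show "w (w i) = i"
      using w_invol[OF i(1)] .
    then show "w i \<in> F y x"
      using w_range[OF i(1)] i(2,3) by (simp add: F_def abs_le_iff minus_le_iff)
  qed
  show "bij_betw w (F x y) (F y x)"
    by (rule bij_betw_byWitness[where f' = w]) (use mem in blast)+
  show "strict_mono_on (F x y) w"
  proof (rule strict_mono_onI)
    fix i j assume "i \<in> F x y" "j \<in> F x y" "i < j"
    then show "w i < w j"
      using lex_less[of i j] by (simp add: F_def)
  qed
qed (use assms in simp)

end

text \<open>The multiset fixes the sorted function \<open>(g i, g (w i))\<close>, hence
  \<open>g\<close> and all fibres; the rank of \<open>w i\<close> in its fibre then fixes
  \<open>w i\<close>.\<close>

lemma inj_on_cell_mset: "inj_on (cell_mset m) {(w, g). matched_pair m r w g}"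
proof (rule inj_onI; clarify)
  fix w g w' g'
  assume mp: "matched_pair m r w g" "matched_pair m r w' g'"
    and eq: "cell_mset m (w, g) = cell_mset m (w', g')"
  have cell: "(g i, g (w i)) = (g' i, g' (w' i))" if "i \<in> {- int m..int m}" for i
    using that eq mp by (intro mono_on_unique[of "- int m" "int m" "\<lambda>i. (g i, g (w i))"])
      (auto simp: mono_on_cell simp flip: symmetrize_cell_mset)
  have "g i = g' i" for i
    using cell[of i] matched_pair_outside[OF mp(1), of i] matched_pair_outside[OF mp(2), of i]
    by (cases "\<bar>i\<bar> \<le> int m") (auto simp: abs_le_iff)
  then have g: "g = g'" ..
  have "w i = w' i" for i
  proof (cases "\<bar>i\<bar> \<le> int m")
    case True
    define F where "F w = (\<lambda>x y. {j \<in> {- int m..int m}. g j = x \<and> g (w j) = y})"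
      for w :: "int \<Rightarrow> int"
    have F: "F w = F w'"
      using cell by (auto simp: F_def g fun_eq_iff)
    have "rank (F w (g (w i)) (g i)) (w i) = rank (F w' (g' (w' i)) (g' i)) (w' i)"
      using rank_w[OF mp(1), of i "g i" "g (w i)"] rank_w[OF mp(2), of i "g' i" "g' (w' i)"] True
        cell[of i] fun_cong[OF fun_cong[OF F]] by (simp add: F_def g abs_le_iff minus_le_iff)
    moreover have "w i \<in> F w (g (w i)) (g i)" "w' i \<in> F w' (g' (w' i)) (g' i)"
      using True w_range[OF mp(1)] w_range[OF mp(2)] w_invol[OF mp(1)] w_invol[OF mp(2)]
      by (auto simp: F_def g abs_le_iff minus_le_iff)
    moreover have "finite (F w x y)" for x y
      by (rule finite_subset[of _ "{- int m..int m}"]) (auto simp: F_def)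
    ultimately show ?thesis
      using rank_eq_iff[of "F w (g (w i)) (g i)" "w i" "w' i"] F cell[of i] True
      by (simp add: g abs_le_iff minus_le_iff)
  qed (use matched_pair_outside[OF mp(1)] matched_pair_outside[OF mp(2)] in simp)
  then show "w = w' \<and> g = g'"
    using g by auto
qed

section \<open>From multisets to matched pairs\<close>

lemma card_fiber:
  assumes "image_mset p (mset_set A) = M" "finite A"
  shows "card {i \<in> A. p i = v} = count M v"
proof -
  have "{x. x \<in># mset_set A \<and> v = p x} = {i \<in> A. p i = v}"
    using assms(2) by auto
  then have "count (image_mset p (mset_set A)) v = (\<Sum>x\<in>{i \<in> A. p i = v}. count (mset_set A) x)"
    by (simp only: count_image_mset')
  also have "\<dots> = (\<Sum>x\<in>{i \<in> A. p i = v}. 1)"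
    by (rule sum.cong) (use assms(2) in auto)
  finally show ?thesis
    using assms by simp
qed

lemma exists_sorting_function:
  fixes M :: "'a::linorder multiset"
  assumes "size M = 2 * m + 1"
  obtains p :: "int \<Rightarrow> 'a" where "mono_on {- int m..int m} p"
    and "image_mset p (mset_set {- int m..int m}) = M"
proof
  let ?L = "sorted_list_of_multiset M"
  let ?p = "\<lambda>i. ?L ! nat (i + int m)"
  have len: "length ?L = 2 * m + 1"
    using assms by (metis mset_sorted_list_of_multiset size_mset)
  show "mono_on {- int m..int m} ?p"
    by (rule mono_onI, rule sorted_nth_mono) (use len in auto)
  have "map ?p [- int m..int m] = ?L"
    by (rule nth_equalityI) (use len in auto)
  then have "mset (map ?p [- int m..int m]) = M"
    by simp
  then show "image_mset ?p (mset_set {- int m..int m}) = M"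
    by (simp add: mset_set_set[symmetric])
qed

text \<open>Negating both coordinates reverses the lexicographic order, and so does negating the
  position.\<close>

lemma mono_on_reflect:
  fixes p :: "int \<Rightarrow> int \<times> int"
  assumes "mono_on {- b..b} p"
  shows "mono_on {- b..b} (\<lambda>i. (- fst (p (- i)), - snd (p (- i))))"
proof (rule mono_onI)
  fix i j assume "i \<in> {- b..b}" "j \<in> {- b..b}" "i \<le> j"
  then have "p (- j) \<le> p (- i)"
    by (intro mono_onD[OF assms]) auto
  then show "(- fst (p (- i)), - snd (p (- i))) \<le> (- fst (p (- j)), - snd (p (- j)))"
    by (auto simp: less_eq_prod_def)
qed

lemma image_mset_uminus_interval:
  "image_mset uminus (mset_set {- b..b}) = mset_set {- b..b :: int}"
  by (subst image_mset_mset_set) (auto intro: inj_onI)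

lemma count_symmetrize_swap: "count (symmetrize C) (y, x) = count (symmetrize C) (x, y)"
  by (auto simp: count_symmetrize)

section \<open>Reconstruction from a sorting \<open>p\<close> of the symmetrized multiset\<close>

context
  fixes m n r :: nat and C :: "(int \<times> int) multiset" and p :: "int \<Rightarrow> int \<times> int"
  assumes C: "C \<in> multisets_of_size (cells r) n"
    and p_mono: "mono_on {- int m..int m} p"
    and p_image: "image_mset p (mset_set {- int m..int m}) = symmetrize C"
begin

definition fiber :: "int \<Rightarrow> int \<Rightarrow> int set" where
  "fiber x y = {i \<in> {- int m..int m}. p i = (x, y)}"

lemma finite_fiber: "finite (fiber x y)"
  by (rule finite_subset[of _ "{- int m..int m}"]) (auto simp: fiber_def)

lemma card_fiber_eq: "card (fiber x y) = count (symmetrize C) (x, y)"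
  unfolding fiber_def by (rule card_fiber[OF p_image]) simp

lemma card_fiber_swap: "card (fiber y x) = card (fiber x y)"
  by (simp add: card_fiber_eq count_symmetrize_swap)

text \<open>The symmetrized multiset is invariant under negation, so the reflected function
  \<open>?q\<close> sorts it too and must equal \<open>p\<close>.\<close>

lemma p_odd:
  assumes "i \<in> {- int m..int m}"
  shows "p (- i) = (- fst (p i), - snd (p i))"
proof -
  let ?q = "\<lambda>i. (- fst (p (- i)), - snd (p (- i)))"
  let ?neg = "\<lambda>(x, y). (- x, - y) :: int \<times> int"
  have "image_mset ?q (mset_set {- int m..int m})
      = image_mset ?neg (image_mset p (image_mset uminus (mset_set {- int m..int m})))"
    by (simp add: multiset.map_comp comp_def split_beta)
  also have "\<dots> = image_mset ?neg (symmetrize C)"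
    by (simp only: image_mset_uminus_interval p_image)
  also have "\<dots> = symmetrize C"
    by (rule multiset_eqI) (auto simp: count_image_mset_involution count_symmetrize split_beta)
  finally have "p (- i) = ?q (- i)"
    using assms p_image p_mono mono_on_reflect[OF p_mono]
    by (intro mono_on_unique[of "- int m" "int m" p ?q]) auto
  then show ?thesis
    by simp
qed

lemma fiber_uminus: "fiber (- x) (- y) = uminus ` fiber x y"
proof -
  have "- i \<in> fiber (- x) (- y)" if "i \<in> fiber x y" for i x y
    using that p_odd[of i] by (auto simp: fiber_def)
  from this[of _ x y] this[of _ "- x" "- y"] show ?thesis
    by (force intro: image_eqI[of _ uminus "- _"])
qed

text \<open>No cell is diagonal, so the only diagonal value is the added \<open>(0, 0)\<close>, and
  oddness of \<open>p\<close> places it at position 0.\<close>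

lemma diagonal_fiber: "fiber x x \<subseteq> {0}"
proof -
  have "count C (z, z) = 0" for z
    using C by (auto simp: count_eq_zero_iff multisets_of_size_def mem_cells)
  then have card: "card (fiber x x) = of_bool (x = 0)" for x
    by (simp add: card_fiber_eq count_symmetrize)
  have "0 \<in> fiber 0 0"
    using p_odd[of 0] by (auto simp: fiber_def prod_eq_iff)
  then have "fiber 0 0 = {0}"
    using card[of 0] by (auto simp: card_1_singleton_iff)
  then show ?thesis
    using card[of x] finite_fiber[of x x] by (cases "x = 0") auto
qed

lemma even_antidiagonal_fiber:
  assumes "x \<noteq> 0"
  shows "even (card (fiber x (- x)))"
proof -
  have "card (fiber x (- x)) = 2 * (count C (x, - x) + count C (- x, x))"
    using assms by (simp add: card_fiber_eq count_symmetrize)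
  then show ?thesis
    by simp
qed

text \<open>By \<open>rank_w\<close> this is the only candidate for \<open>w\<close>.\<close>

definition partner :: "int \<Rightarrow> int" where
  "partner i = (if i \<in> {- int m..int m} then
     (let (x, y) = p i in inv_into (fiber y x) (rank (fiber y x)) (rank (fiber x y) i)) else 0)"

text \<open>A fibre and its swap have the same size, so every rank in one is attained in the
  other.\<close>

lemma partner:
  assumes "i \<in> fiber x y"
  shows "partner i \<in> fiber y x" "rank (fiber y x) (partner i) = rank (fiber x y) i"
proof -
  have "bij_betw (rank (fiber y x)) (fiber y x) {..<card (fiber y x)}"
    by (rule bij_betw_rank[OF finite_fiber])
  moreover have "rank (fiber x y) i < card (fiber y x)"
    using bij_betw_rank[OF finite_fiber, of x y] assms
    by (auto simp: card_fiber_swap[of x y] bij_betw_def)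
  ultimately have "rank (fiber x y) i \<in> rank (fiber y x) ` fiber y x"
    by (simp add: bij_betw_def)
  moreover have "partner i = inv_into (fiber y x) (rank (fiber y x)) (rank (fiber x y) i)"
    using assms by (simp add: partner_def fiber_def)
  ultimately show "partner i \<in> fiber y x" "rank (fiber y x) (partner i) = rank (fiber x y) i"
    by (simp_all add: inv_into_into f_inv_into_f)
qed

lemma partner_unique:
  assumes "i \<in> fiber x y" "j \<in> fiber y x" "rank (fiber y x) j = rank (fiber x y) i"
  shows "partner i = j"
  using partner[OF assms(1)] assms(2,3) rank_eq_iff[OF finite_fiber] by metis

lemma in_fiber: "i \<in> {- int m..int m} \<Longrightarrow> i \<in> fiber (fst (p i)) (snd (p i))"
  by (simp add: fiber_def)

lemma p_partner: "i \<in> {- int m..int m} \<Longrightarrow> p (partner i) = (snd (p i), fst (p i))"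
  and partner_range: "i \<in> {- int m..int m} \<Longrightarrow> partner i \<in> {- int m..int m}"
  using partner(1)[OF in_fiber] by (auto simp: fiber_def)

lemma partner_partner:
  assumes "i \<in> {- int m..int m}"
  shows "partner (partner i) = i"
  using partner[OF in_fiber[OF assms]] in_fiber[OF assms] by (intro partner_unique) auto

text \<open>Negation complements ranks with respect to the fibre size, which is the same for both
  fibres, so equal ranks stay equal.\<close>

lemma partner_uminus: "partner (- i) = - partner i"
proof (cases "i \<in> {- int m..int m}")
  case True
  define x y where "x = fst (p i)" "y = snd (p i)"
  have i: "i \<in> fiber x y"
    using in_fiber[OF True] by (simp add: x_y_def)
  note j = partner[OF i]
  have "rank (fiber (- y) (- x)) (- partner i) + rank (fiber y x) (partner i) + 1 = card (fiber y x)"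
    unfolding fiber_uminus by (rule rank_uminus[OF finite_fiber j(1)])
  moreover have "rank (fiber (- x) (- y)) (- i) + rank (fiber x y) i + 1 = card (fiber x y)"
    unfolding fiber_uminus by (rule rank_uminus[OF finite_fiber i])
  ultimately have "rank (fiber (- y) (- x)) (- partner i) = rank (fiber (- x) (- y)) (- i)"
    using j(2) card_fiber_swap[of x y] by simp
  then show ?thesis
    by (intro partner_unique) (use i j(1) fiber_uminus in auto)
next
  case False
  then have "- i \<notin> {- int m..int m}"
    by auto
  with False show ?thesis
    unfolding partner_def by (simp only: if_False minus_zero)
qed

text \<open>\<open>partner i = i\<close> would put \<open>i\<close> in a diagonal fibre.
  \<open>partner i = - i\<close> would make \<open>i\<close> the middle element of an antidiagonal
  fibre, whose size is even.\<close>

lemma partner_free: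
  assumes "i \<in> {- int m..int m}" "i \<noteq> 0"
  shows "\<bar>partner i\<bar> \<noteq> \<bar>i\<bar>"
proof
  assume "\<bar>partner i\<bar> = \<bar>i\<bar>"
  then consider "partner i = i" | "partner i = - i"
    by linarith
  then show False
  proof cases
    case 1
    then have "p i = (snd (p i), fst (p i))"
      using p_partner[OF assms(1)] by simp
    then have "fst (p i) = snd (p i)"
      by (metis fst_conv)
    then show False
      using in_fiber[OF assms(1)] diagonal_fiber[of "fst (p i)"] assms(2) by auto
  next
    case 2
    define x where "x = fst (p i)"
    have "(snd (p i), fst (p i)) = (- fst (p i), - snd (p i))"
      using p_partner[OF assms(1)] p_odd[OF assms(1)] 2 by simp
    then have "snd (p i) = - fst (p i)"
      by (rule Pair_inject)
    then have i: "i \<in> fiber x (- x)"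
      using in_fiber[OF assms(1)] by (simp add: x_def)
    have "x \<noteq> 0"
    proof
      assume "x = 0"
      then have "i \<in> fiber 0 0"
        using i by simp
      then show False
        using diagonal_fiber[of 0] assms(2) by blast
    qed
    have "rank (fiber (- x) x) (- i) = rank (fiber x (- x)) i"
      using partner(2)[OF i] 2 by simp
    moreover have "rank (fiber (- x) (- (- x))) (- i) + rank (fiber x (- x)) i + 1
        = card (fiber x (- x))"
      unfolding fiber_uminus by (rule rank_uminus[OF finite_fiber i])
    ultimately have "card (fiber x (- x)) = 2 * rank (fiber x (- x)) i + 1"
      unfolding minus_minus by linarith
    then show False
      using even_antidiagonal_fiber[OF \<open>x \<noteq> 0\<close>] by simp
  qed
qed

text \<open>Within one fibre ranks decide. If only the first coordinates agree, the second ones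
  increase strictly; swapped, they come first, and monotonicity of \<open>p\<close> orders the
  partners.\<close>

lemma partner_lex:
  assumes "i \<in> {- int m..int m}" "j \<in> {- int m..int m}" "i < j"
  shows "(fst (p i), partner i) < (fst (p j), partner j)"
proof -
  have mono: "p a \<le> p b" if "a \<in> {- int m..int m}" "b \<in> {- int m..int m}" "a \<le> b" for a b
    using that p_mono by (auto simp: mono_on_def)
  have "partner i < partner j" if eq: "fst (p i) = fst (p j)"
  proof (cases "snd (p i) = snd (p j)")
    case True
    define x y where "x = fst (p i)" "y = snd (p i)"
    have ij: "i \<in> fiber x y" "j \<in> fiber x y"
      using in_fiber[OF assms(1)] in_fiber[OF assms(2)] eq True by (simp_all add: x_y_def)
    have "rank (fiber y x) (partner i) < rank (fiber y x) (partner j)"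
      using rank_strict_mono[OF finite_fiber ij(1) assms(3)] partner(2)[OF ij(1)] partner(2)[OF ij(2)]
      by simp
    then show ?thesis
      using rank_strict_mono[OF finite_fiber partner(1)[OF ij(2)], of "partner i"]
      by (cases "partner i" "partner j" rule: linorder_cases) auto
  next
    case False
    then have "snd (p i) < snd (p j)"
      using mono[of i j] assms eq by (auto simp: less_eq_prod_def)
    then have "\<not> p (partner j) \<le> p (partner i)"
      using p_partner assms by auto
    then show ?thesis
      using mono partner_range assms by (meson linorder_not_less)
  qed
  moreover have "fst (p i) \<le> fst (p j)"
    using mono[of i j] assms by (auto simp: less_eq_prod_def)
  ultimately show ?thesis
    by (auto simp: order.order_iff_strict)
qed

lemma p_bounded:
  assumes "i \<in> {- int m..int m}"
  shows "\<bar>fst (p i)\<bar> \<le> int r"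
proof -
  have C: "1 \<le> x \<and> x \<le> int r \<and> - x \<le> y \<and> y < x" if "(x, y) \<in># C" for x y
    using that C mem_cells by (force simp: multisets_of_size_def)
  have "p i \<in># image_mset p (mset_set {- int m..int m})"
    using assms by (simp only: set_image_mset finite_set_mset_mset_set finite_atLeastAtMost_int) blast
  then show ?thesis
    unfolding p_image by (cases "p i") (auto simp: symmetrize_def dest!: C)
qed

lemma matched_pair_partner:
  "matched_pair m r partner (\<lambda>i. if i \<in> {- int m..int m} then fst (p i) else 0)"
proof -
  have dom: "\<bar>i\<bar> \<le> int m \<longleftrightarrow> i \<in> {- int m..int m}" "- i \<in> {- int m..int m} \<longleftrightarrow> i \<in> {- int m..int m}"
    for i by auto
  have "partner i = 0" if "i \<notin> {- int m..int m}" for i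
    unfolding partner_def using that by (rule if_not_P)
  moreover have "\<bar>fst (p i)\<bar> \<le> int r" if "i \<in> {- int m..int m}" for i
    using p_bounded[OF that] .
  ultimately show ?thesis
    using p_odd partner_uminus partner_partner partner_range partner_free partner_lex
    unfolding matched_pair_def strict_mono_on_def not_le[symmetric] dom
    by (simp del: atLeastAtMost_iff add: dom)
qed

end

lemma bij_betw_cell_mset:
  "bij_betw (cell_mset (2 * n)) {(w, g). matched_pair (2 * n) r w g} (multisets_of_size (cells r) n)"
proof (rule bij_betwI')
  fix s t assume "s \<in> {(w, g). matched_pair (2 * n) r w g}" "t \<in> {(w, g). matched_pair (2 * n) r w g}"
  then show "cell_mset (2 * n) s = cell_mset (2 * n) t \<longleftrightarrow> s = t"
    using inj_on_cell_mset by (metis inj_on_eq_iff)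
next
  fix s assume "s \<in> {(w, g). matched_pair (2 * n) r w g}"
  then show "cell_mset (2 * n) s \<in> multisets_of_size (cells r) n"
    using cell_mset_subset size_cell_mset by (fastforce simp: multisets_of_size_def)
next
  fix C assume C: "C \<in> multisets_of_size (cells r) n"
  then have "size (symmetrize C) = 2 * (2 * n) + 1"
    by (simp add: size_symmetrize multisets_of_size_def)
  then obtain p where p: "mono_on {- int (2 * n)..int (2 * n)} p"
    "image_mset p (mset_set {- int (2 * n)..int (2 * n)}) = symmetrize C"
    using exists_sorting_function by metis
  define w where "w = partner (2 * n) p"
  define g where "g i = (if i \<in> {- int (2 * n)..int (2 * n)} then fst (p i) else 0)" for i
  have mp: "matched_pair (2 * n) r w g"
    using matched_pair_partner[OF C p] by (simp add: w_def g_def[abs_def])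
  have "(g i, g (w i)) = p i" if "i \<in> {- int (2 * n)..int (2 * n)}" for i
    using p_partner[OF C p that] partner_range[OF C p that] that by (simp add: g_def w_def)
  then have "symmetrize (cell_mset (2 * n) (w, g)) = symmetrize C"
    unfolding symmetrize_cell_mset[OF mp] p(2)[symmetric] by (intro image_mset_cong) simp
  \<comment> \<open>The constructed pair reproduces \<open>p\<close>, so both multisets have the
    same symmetrization.\<close>
  then have "C = cell_mset (2 * n) (w, g)"
    using symmetrize_inject cell_mset_subset[OF mp] C by (metis multisets_of_size_subset)
  then show "\<exists>s \<in> {(w, g). matched_pair (2 * n) r w g}. C = cell_mset (2 * n) s"
    using mp by auto
qed

section \<open>Signed involutions with bar sequences\<close>

definition odd_ext :: "(nat \<Rightarrow> int) \<Rightarrow> int \<Rightarrow> int" where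
  "odd_ext f i = (if 0 \<le> i then f (nat i) else - f (nat (- i)))"

lemma odd_ext_of_nat [simp]: "odd_ext f (int i) = f i"
  by (simp add: odd_ext_def)

lemma odd_ext_uminus: "f 0 = 0 \<Longrightarrow> odd_ext f (- i) = - odd_ext f i"
  by (simp add: odd_ext_def)

lemma odd_ext_restrict:
  assumes "\<And>i. w (- i) = - w i"
  shows "odd_ext (\<lambda>i. w (int i)) = w"
  using assms by (auto simp: odd_ext_def fun_eq_iff)

definition matchings :: "nat \<Rightarrow> (nat \<Rightarrow> int) set" where
  "matchings m = {\<pi>. signed_involution m \<pi> \<and> fixed_point_free m \<pi>}"

lemma finite_matchings: "finite (matchings m)"
  by (rule finite_subset[OF _ finite_signed_perms[of m]])
    (auto simp: matchings_def signed_involution_def)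

text \<open>The rule for the inverse at \<open>\<bar>\<pi> i\<bar>\<close> says that the odd
  extension of the inverse sends \<open>\<pi> i\<close> to \<open>i\<close>; being an involution
  thus means that the odd extension of \<open>\<pi>\<close> undoes itself.\<close>

lemma matchings_iff:
  "\<pi> \<in> matchings m \<longleftrightarrow> (\<forall>i. i \<notin> {1..m} \<longrightarrow> \<pi> i = 0) \<and>
     (\<forall>i\<in>{1..m}. 1 \<le> \<bar>\<pi> i\<bar> \<and> \<bar>\<pi> i\<bar> \<le> int m \<and> \<bar>\<pi> i\<bar> \<noteq> int i \<and> odd_ext \<pi> (\<pi> i) = int i)"
  (is "_ \<longleftrightarrow> ?R")
proof
  assume pi: "\<pi> \<in> matchings m"
  then have sp: "\<pi> \<in> signed_perms m" and inv: "signed_inverse m \<pi> = \<pi>"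
    and fpf: "fixed_point_free m \<pi>"
    by (auto simp: matchings_def signed_involution_def)
  have "1 \<le> \<bar>\<pi> i\<bar> \<and> \<bar>\<pi> i\<bar> \<le> int m \<and> \<bar>\<pi> i\<bar> \<noteq> int i \<and> odd_ext \<pi> (\<pi> i) = int i"
    if i: "i \<in> {1..m}" for i
  proof -
    have "nat \<bar>\<pi> i\<bar> \<in> {1..m}"
      using sp i bij_betwE[of "\<lambda>i. nat \<bar>\<pi> i\<bar>" "{1..m}" "{1..m}"]
      unfolding signed_perms_def by blast
    then have range: "1 \<le> \<bar>\<pi> i\<bar>" "\<bar>\<pi> i\<bar> \<le> int m"
      by auto
    have "\<pi> (nat \<bar>\<pi> i\<bar>) = sgn (\<pi> i) * int i"
      using signed_inverse_abs[OF sp i] inv by simp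
    then have "odd_ext \<pi> (\<pi> i) = int i"
      using range by (cases "0 \<le> \<pi> i") (auto simp: odd_ext_def sgn_if split: if_splits)
    moreover have "\<bar>\<pi> i\<bar> \<noteq> int i"
    proof -
      have "\<pi> i \<noteq> int i" "\<pi> i \<noteq> - int i"
        using fpf i by (simp_all add: fixed_point_free_def)
      then show ?thesis
        by linarith
    qed
    ultimately show ?thesis
      using range by simp
  qed
  then show ?R
    using sp by (auto simp: signed_perms_def)
next
  assume R: ?R
  let ?f = "\<lambda>i. nat \<bar>\<pi> i\<bar>"
  have f_mem: "?f i \<in> {1..m}" if "i \<in> {1..m}" for i
    using R that by force
  have \<pi>_f: "\<pi> (?f i) = sgn (\<pi> i) * int i" if "i \<in> {1..m}" for i
  proof -
    have "odd_ext \<pi> (\<pi> i) = int i" "1 \<le> \<bar>\<pi> i\<bar>"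
      using R that by blast+
    then show ?thesis
      by (cases "0 \<le> \<pi> i") (auto simp: odd_ext_def sgn_if)
  qed
  have ff: "?f (?f i) = i" if "i \<in> {1..m}" for i
  proof -
    have "\<pi> i \<noteq> 0"
      using R that by force
    then show ?thesis
      using \<pi>_f[OF that] by (simp add: abs_mult abs_sgn_eq)
  qed
  have bij: "bij_betw ?f {1..m} {1..m}"
    by (rule bij_betw_byWitness[where f' = ?f]) (use ff f_mem in blast)+
  then have sp: "\<pi> \<in> signed_perms m"
    using R by (simp add: signed_perms_def)
  have "signed_inverse m \<pi> j = \<pi> j" for j
  proof (cases "j \<in> {1..m}")
    case True
    have inv: "inv_into {1..m} ?f j = ?f j"
      by (rule inv_into_f_eq) (use bij f_mem[OF True] ff[OF True] in \<open>auto simp: bij_betw_def\<close>)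
    have "sgn (\<pi> (?f j)) = sgn (\<pi> j)"
      using \<pi>_f[OF True] True by (simp add: sgn_mult)
    then have "signed_inverse m \<pi> j = sgn (\<pi> j) * \<bar>\<pi> j\<bar>"
      using True by (simp only: signed_inverse_def inv Let_def if_True) simp
    then show ?thesis
      by (simp add: sgn_mult_abs)
  next
    case False
    then show ?thesis
      using R unfolding signed_inverse_def by auto
  qed
  moreover have "fixed_point_free m \<pi>"
    using R by (force simp: fixed_point_free_def)
  ultimately show "\<pi> \<in> matchings m"
    using sp by (auto simp: matchings_def signed_involution_def)
qed

text \<open>The type B analogue of \<open>P\<close>-partitions; the value \<open>a 0 = 0\<close> makes \<open>a\<close> nonnegative.\<close>

definition barred :: "nat \<Rightarrow> nat \<Rightarrow> (nat \<Rightarrow> int) \<Rightarrow> (nat \<Rightarrow> int) set" where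
  "barred m r \<pi> = {a. (\<forall>i. i \<notin> {1..m} \<longrightarrow> a i = 0) \<and> a m \<le> int r \<and>
     (\<forall>i<m. a i \<le> a (Suc i) \<and> (\<pi> i > \<pi> (Suc i) \<longrightarrow> a i < a (Suc i)))}"

lemma barred_mono:
  assumes "a \<in> barred m r \<pi>" "i \<le> j" "j \<le> m"
  shows "a i \<le> a j"
  using assms(2,3)
proof (induction rule: dec_induct)
  case (step k)
  moreover have "a k \<le> a (Suc k)"
    using assms(1) step by (simp add: barred_def)
  ultimately show ?case
    by simp
qed simp

lemma barred_range:
  assumes "a \<in> barred m r \<pi>"
  shows "0 \<le> a i" "a i \<le> int r"
proof -
  have "0 \<le> a i \<and> a i \<le> int r"
  proof (cases "i \<le> m")
    case True
    have "a 0 = 0" "a m \<le> int r"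
      using assms by (simp_all add: barred_def)
    then show ?thesis
      using barred_mono[OF assms _ True, of 0] barred_mono[OF assms True] by simp
  next
    case False
    then show ?thesis
      using assms by (simp add: barred_def)
  qed
  then show "0 \<le> a i" "a i \<le> int r"
    by simp_all
qed

section \<open>Counting the bar sequences of one signed permutation\<close>

lemma des_B_Suc: "des_B (Suc m) \<pi> = des_B m \<pi> + of_bool (\<pi> m > \<pi> (Suc m))"
proof -
  have "{i \<in> {0..<Suc m}. \<pi> i > \<pi> (i + 1)}
      = {i \<in> {0..<m}. \<pi> i > \<pi> (i + 1)} \<union> (if \<pi> m > \<pi> (Suc m) then {m} else {})"
    by (auto simp: less_Suc_eq)
  then show ?thesis
    by (auto simp: des_B_def)
qed

lemma des_B_le: "des_B m \<pi> \<le> m"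
proof (induction m)
  case (Suc m)
  then show ?case
    by (simp add: des_B_Suc)
qed (simp add: des_B_def)

lemma barredD:
  assumes "a \<in> barred m r \<pi>"
  shows "i \<notin> {1..m} \<Longrightarrow> a i = 0" "a m \<le> int r"
    "i < m \<Longrightarrow> a i \<le> a (Suc i)" "i < m \<Longrightarrow> \<pi> i > \<pi> (Suc i) \<Longrightarrow> a i < a (Suc i)"
  using assms unfolding barred_def by blast+

lemma barredI:
  assumes "\<And>i. i \<notin> {1..m} \<Longrightarrow> a i = 0" "a m \<le> int r"
    "\<And>i. i < m \<Longrightarrow> a i \<le> a (Suc i)"
    "\<And>i. i < m \<Longrightarrow> \<pi> i > \<pi> (Suc i) \<Longrightarrow> a i < a (Suc i)"
  shows "a \<in> barred m r \<pi>"
  using assms unfolding barred_def by blast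

text \<open>With bound 0 every value is 0, which leaves no room for a descent.\<close>

lemma barred_Suc_0:
  "barred (Suc m) 0 \<pi> = (if \<pi> m > \<pi> (Suc m) then {} else barred m 0 \<pi>)"
proof -
  have zero: "a i = 0" if "a \<in> barred k 0 \<pi>" for a i k
    using barred_range[OF that, of i] by simp
  have "\<not> \<pi> m > \<pi> (Suc m) \<and> a \<in> barred m 0 \<pi>" if a: "a \<in> barred (Suc m) 0 \<pi>" for a
  proof -
    have "\<not> \<pi> i > \<pi> (Suc i)" if "i < Suc m" for i
      using barredD(4)[OF a that] zero[OF a] by auto
    then show ?thesis
      by (intro conjI barredI) (simp_all add: zero[OF a])
  qed
  moreover have "a \<in> barred (Suc m) 0 \<pi>" if a: "a \<in> barred m 0 \<pi>" "\<not> \<pi> m > \<pi> (Suc m)" for a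
    using zero[OF a(1)] barredD(4)[OF a(1)] a(2) by (auto intro!: barredI simp: less_Suc_eq)
  ultimately show ?thesis
    by auto
qed

text \<open>Split by whether the last value reaches the bound \<open>r + 1\<close>; if it does, a
  descent at \<open>m\<close> forces \<open>a m \<le> r\<close>.\<close>

lemma barred_Suc_Suc:
  "barred (Suc m) (Suc r) \<pi> = barred (Suc m) r \<pi> \<union>
     (\<lambda>a. a(Suc m := int (Suc r))) ` barred m (Suc r - of_bool (\<pi> m > \<pi> (Suc m))) \<pi>"
  (is "_ = _ \<union> ?g ` barred m ?s \<pi>")
proof (intro equalityI subsetI)
  fix a assume a: "a \<in> barred (Suc m) (Suc r) \<pi>"
  show "a \<in> barred (Suc m) r \<pi> \<union> ?g ` barred m ?s \<pi>"
  proof (cases "a (Suc m) \<le> int r")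
    case True
    then have "a \<in> barred (Suc m) r \<pi>"
      using barredD[OF a] by (intro barredI)
    then show ?thesis
      by blast
  next
    case False
    then have eq: "a (Suc m) = int (Suc r)"
      using barredD(2)[OF a] by simp
    \<comment> \<open>Sequences of length \<open>m\<close> vanish beyond \<open>m\<close>, so the
      removed last entry is reset to 0.\<close>
    have "a(Suc m := 0) \<in> barred m ?s \<pi>"
    proof (rule barredI)
      show "(a(Suc m := 0)) m \<le> int ?s"
        using barredD(3,4)[OF a, of m] eq by auto
    qed (use barredD(1,3,4)[OF a] in auto)
    moreover have "a = ?g (a(Suc m := 0))"
      using eq by (simp add: fun_eq_iff)
    ultimately show ?thesis
      by blast
  qed
next
  fix a assume "a \<in> barred (Suc m) r \<pi> \<union> ?g ` barred m ?s \<pi>"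
  then consider "a \<in> barred (Suc m) r \<pi>" | b where "b \<in> barred m ?s \<pi>" "a = ?g b"
    by blast
  then show "a \<in> barred (Suc m) (Suc r) \<pi>"
  proof cases
    case 1
    then show ?thesis
      using barredD(2)[OF 1] by (intro barredI) (auto dest: barredD)
  next
    case 2
    have "b m \<le> int (Suc r)" "\<pi> m > \<pi> (Suc m) \<Longrightarrow> b m < int (Suc r)"
      using barredD(2)[OF 2(1)] by (cases "\<pi> m > \<pi> (Suc m)"; simp)+
    then show ?thesis
      unfolding 2(2) using barredD(1,3,4)[OF 2(1)] by (intro barredI) (auto simp: less_Suc_eq)
  qed
qed

text \<open>The splitting in \<open>barred_Suc_Suc\<close> is Pascal's rule. More than
  \<open>r\<close> descents make the upper index smaller than \<open>m\<close>, so the count is 0 as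
  it should be.\<close>

lemma card_barred:
  "finite (barred m r \<pi>) \<and> card (barred m r \<pi>) = (m + r - des_B m \<pi>) choose m"
proof (induction m arbitrary: r)
  case 0
  have "barred 0 r \<pi> = {\<lambda>i. 0}"
    by (auto simp: barred_def)
  then show ?case
    by simp
next
  case (Suc m)
  note Suc_m = Suc.IH
  have des: "des_B m \<pi> \<le> m"
    by (rule des_B_le)
  show ?case
  proof (induction r)
    case 0
    \<comment> \<open>Both sides are 1 without descents and 0 otherwise.\<close>
    have "(Suc m - des_B m \<pi>) choose Suc m = (m - des_B m \<pi>) choose m"
      using des by (cases "des_B m \<pi> = 0") (simp_all add: binomial_eq_0)
    then show ?case
      using Suc.IH[of 0] by (simp add: barred_Suc_0 des_B_Suc less_Suc_eq_le)
  next
    case (Suc r)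
    let ?d = "of_bool (\<pi> m > \<pi> (Suc m)) :: nat"
    let ?g = "\<lambda>a :: nat \<Rightarrow> int. a(Suc m := int (Suc r))"
    have "inj_on ?g (barred m s \<pi>)" for s
    proof (rule inj_onI)
      fix a b assume "a \<in> barred m s \<pi>" "b \<in> barred m s \<pi>" and eq: "?g a = ?g b"
      then have "a (Suc m) = b (Suc m)"
        by (simp add: barred_def)
      then show "a = b"
        using eq by (metis fun_upd_triv fun_upd_upd)
    qed
    then have image: "card (?g ` barred m s \<pi>) = (m + s - des_B m \<pi>) choose m" for s
      using Suc_m by (simp add: card_image)
    \<comment> \<open>A descent at \<open>m\<close> lowers the bound in one summand and raises the
      descent number in the other, so both have upper index \<open>t\<close>.\<close>
    define t where "t = Suc m + r - des_B (Suc m) \<pi>"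
    have t: "m + (Suc r - ?d) - des_B m \<pi> = t" "Suc m + Suc r - des_B (Suc m) \<pi> = Suc t"
      using des by (auto simp: t_def des_B_Suc)
    have "a (Suc m) \<le> int r" if "a \<in> barred (Suc m) r \<pi>" for a
      using that by (simp add: barred_def)
    then have "barred (Suc m) r \<pi> \<inter> ?g ` barred m (Suc r - ?d) \<pi> = {}"
      by fastforce
    then have "card (barred (Suc m) (Suc r) \<pi>)
        = card (barred (Suc m) r \<pi>) + card (?g ` barred m (Suc r - ?d) \<pi>)"
      unfolding barred_Suc_Suc using Suc.IH Suc_m by (intro card_Un_disjoint) auto
    also have "\<dots> = (t choose Suc m) + (t choose m)"
      using Suc.IH by (simp only: image t t_def)
    also have "\<dots> = (Suc t choose Suc m)"
      by simp
    finally have "card (barred (Suc m) (Suc r) \<pi>) = (Suc t choose Suc m)" .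
    moreover have "finite (barred (Suc m) (Suc r) \<pi>)"
      unfolding barred_Suc_Suc using Suc.IH Suc_m by auto
    ultimately show ?case
      unfolding t(2) by blast
  qed
qed

lemma card_Sigma_barred:
  "card (SIGMA \<pi>:matchings m. barred m r \<pi>)
    = (\<Sum>\<pi>\<in>matchings m. (m + r - des_B m \<pi>) choose m)"
  using card_barred by (simp add: card_SigmaI finite_matchings)

lemma sum_J_B_eq_card:
  assumes "0 < m"
  shows "(\<Sum>k\<le>r. J_B m (int k) * ((m + r - k) choose m)) = card (SIGMA \<pi>:matchings m. barred m r \<pi>)"
proof -
  have "J_B m (int k) * ((m + r - k) choose m)
      = (\<Sum>\<pi>\<in>{\<pi> \<in> matchings m. des_B m \<pi> = k}. (m + r - des_B m \<pi>) choose m)" for k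
    by (simp add: J_B_def matchings_def conj_assoc)
  then have "(\<Sum>k\<le>m + r. J_B m (int k) * ((m + r - k) choose m))
      = (\<Sum>k\<le>m + r. \<Sum>\<pi>\<in>{\<pi> \<in> matchings m. des_B m \<pi> = k}. (m + r - des_B m \<pi>) choose m)"
    by (simp only:)
  also have "\<dots> = (\<Sum>\<pi>\<in>matchings m. (m + r - des_B m \<pi>) choose m)"
    using des_B_le[of m] by (intro sum.group finite_matchings) (auto intro: trans_le_add1)
  finally have "(\<Sum>k\<le>m + r. J_B m (int k) * ((m + r - k) choose m))
      = (\<Sum>\<pi>\<in>matchings m. (m + r - des_B m \<pi>) choose m)" .
  \<comment> \<open>Grouping needs a range containing all descent numbers; the extra terms have
    upper index below \<open>m\<close> and vanish.\<close>
  moreover have "(\<Sum>k\<le>r. J_B m (int k) * ((m + r - k) choose m))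
      = (\<Sum>k\<le>m + r. J_B m (int k) * ((m + r - k) choose m))"
    by (rule sum.mono_neutral_left) (use assms in auto)
  ultimately show ?thesis
    by (simp add: card_Sigma_barred)
qed

section \<open>Barred matchings as matched pairs\<close>

lemma matched_pair_odd_ext:
  assumes \<pi>: "\<pi> \<in> matchings m" and a: "a \<in> barred m r \<pi>"
  shows "matched_pair m r (odd_ext \<pi>) (odd_ext a)"
proof -
  note M = \<pi>[unfolded matchings_iff]
  have zero: "\<pi> 0 = 0" "a 0 = 0"
    using M a by (auto simp: barred_def)
  note odd = odd_ext_uminus[of \<pi>, OF zero(1)] odd_ext_uminus[of a, OF zero(2)]
  have outside: "odd_ext \<pi> i = 0 \<and> odd_ext a i = 0" if "\<bar>i\<bar> > int m" for i
  proof -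
    have "nat i \<notin> {1..m}" "nat (- i) \<notin> {1..m}"
      using that by auto
    then show ?thesis
      using M a by (simp add: barred_def odd_ext_def)
  qed
  have nonneg: "\<bar>\<pi> i\<bar> \<le> int m \<and> odd_ext \<pi> (\<pi> i) = int i \<and> (i \<noteq> 0 \<longrightarrow> \<bar>\<pi> i\<bar> \<noteq> int i)" if "i \<le> m" for i
  proof (cases "i = 0")
    case True
    then show ?thesis
      using zero by (simp add: odd_ext_def)
  next
    case False
    then have "i \<in> {1..m}"
      using that by simp
    then show ?thesis
      using M by blast
  qed
  have inside: "\<bar>odd_ext \<pi> i\<bar> \<le> int m \<and> odd_ext \<pi> (odd_ext \<pi> i) = i \<and> \<bar>odd_ext a i\<bar> \<le> int r
      \<and> (i \<noteq> 0 \<longrightarrow> \<bar>odd_ext \<pi> i\<bar> \<noteq> \<bar>i\<bar>)" if "\<bar>i\<bar> \<le> int m" for i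
  proof -
    have "nat \<bar>i\<bar> \<le> m"
      using that by simp
    from nonneg[OF this] show ?thesis
      using odd barred_range[OF a, of "nat \<bar>i\<bar>"]
      by (cases "0 \<le> i") (auto simp: odd_ext_def[of _ i])
  qed
  \<comment> \<open>Adjacent entries of \<open>\<pi>\<close> differ, so a non-descent is a strict
    ascent and the bar condition becomes a strict lexicographic increase.\<close>
  have step: "(a i, \<pi> i) < (a (Suc i), \<pi> (Suc i))" if "i < m" for i
  proof -
    have "\<pi> i \<noteq> \<pi> (Suc i)"
      using nonneg[of i] nonneg[of "Suc i"] that by force
    then show ?thesis
      using a that by (force simp: barred_def)
  qed
  have lex: "(a i, \<pi> i) < (a j, \<pi> j)" if "i < j" "j \<le> m" for i j
    using that
  proof (induction j)
    case (Suc j)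
    then show ?case
      using step[of j] by (cases "i = j") (auto intro: less_trans)
  qed simp
  have pos: "(0, 0) < (a j, \<pi> j)" if "0 < j" "j \<le> m" for j
    using lex[OF that] zero by simp
  have "(odd_ext a i, odd_ext \<pi> i) < (odd_ext a j, odd_ext \<pi> j)"
    if ij: "i \<in> {- int m..int m}" "j \<in> {- int m..int m}" "i < j" for i j
  proof -
    consider "0 \<le> i" | "i < 0" "0 \<le> j" | "j < 0"
      by linarith
    then show ?thesis
    proof cases
      case 1
      then show ?thesis
        using ij lex[of "nat i" "nat j"] by (simp add: odd_ext_def)
    next
      case 2
      \<comment> \<open>Across the origin both sides are compared with the value
        \<open>(0, 0)\<close> at position 0.\<close>
      then have "(0, 0) < (a (nat (- i)), \<pi> (nat (- i)))"
        using ij by (intro pos) auto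
      moreover have "(0, 0) \<le> (a (nat j), \<pi> (nat j))"
        using pos[of "nat j"] 2 ij zero by (cases "j = 0") (auto intro: less_imp_le)
      ultimately show ?thesis
        using 2 by (auto simp: odd_ext_def)
    next
      case 3
      then show ?thesis
        using ij lex[of "nat (- j)" "nat (- i)"] by (auto simp: odd_ext_def)
    qed
  qed
  then show ?thesis
    using odd outside inside unfolding matched_pair_def strict_mono_on_def by blast
qed

lemma matched_pair_restrict:
  assumes mp: "matched_pair m r w g"
  shows "(\<lambda>i. w (int i)) \<in> matchings m" "(\<lambda>i. g (int i)) \<in> barred m r (\<lambda>i. w (int i))"
proof -
  have zero: "w 0 = 0" "g 0 = 0"
    using w_odd[OF mp, of 0] g_odd[OF mp, of 0] by simp_all
  have outside: "w (int i) = 0 \<and> g (int i) = 0" if "i \<notin> {1..m}" for i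
    using that zero matched_pair_outside[OF mp, of "int i"] by (cases "i = 0") auto
  have "1 \<le> \<bar>w (int i)\<bar> \<and> \<bar>w (int i)\<bar> \<le> int m \<and> \<bar>w (int i)\<bar> \<noteq> int i \<and> w (w (int i)) = int i"
    if "i \<in> {1..m}" for i
  proof -
    have i: "\<bar>int i\<bar> \<le> int m" "int i \<noteq> 0"
      using that by auto
    have "w (int i) \<noteq> 0"
      using w_invol[OF mp i(1)] i(2) zero by auto
    then show ?thesis
      using w_range[OF mp i(1)] w_invol[OF mp i(1)] w_free[OF mp i(2,1)] by auto
  qed
  then show "(\<lambda>i. w (int i)) \<in> matchings m"
    using outside unfolding matchings_iff odd_ext_restrict[of w, OF w_odd[OF mp]] by blast
  have "g (int i) \<le> g (int (Suc i)) \<and> (w (int i) > w (int (Suc i)) \<longrightarrow> g (int i) < g (int (Suc i)))"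
    if "i < m" for i
    using lex_less[OF mp, of "int i" "int (Suc i)"] that by auto
  moreover have "g (int m) \<le> int r"
    using g_range[OF mp, of "int m"] by simp
  ultimately show "(\<lambda>i. g (int i)) \<in> barred m r (\<lambda>i. w (int i))"
    using outside unfolding barred_def by blast
qed

lemma bij_betw_odd_ext:
  "bij_betw (\<lambda>(\<pi>, a). (odd_ext \<pi>, odd_ext a)) (SIGMA \<pi>:matchings m. barred m r \<pi>)
     {(w, g). matched_pair m r w g}"
proof (rule bij_betw_byWitness[where f' = "\<lambda>(w, g). (\<lambda>i. w (int i), \<lambda>i. g (int i))"])
  show "\<forall>s\<in>{(w, g). matched_pair m r w g}. (case case s of (w, g) \<Rightarrow> (\<lambda>i. w (int i), \<lambda>i. g (int i)) of
      (\<pi>, a) \<Rightarrow> (odd_ext \<pi>, odd_ext a)) = s"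
  proof clarify
    fix w g assume mp: "matched_pair m r w g"
    show "odd_ext (\<lambda>i. w (int i)) = w \<and> odd_ext (\<lambda>i. g (int i)) = g"
      using odd_ext_restrict[of w] odd_ext_restrict[of g] w_odd[OF mp] g_odd[OF mp] by blast
  qed
  show "(\<lambda>(\<pi>, a). (odd_ext \<pi>, odd_ext a)) ` (SIGMA \<pi>:matchings m. barred m r \<pi>)
      \<subseteq> {(w, g). matched_pair m r w g}"
    by (auto simp: matched_pair_odd_ext)
  show "(\<lambda>(w, g). (\<lambda>i. w (int i), \<lambda>i. g (int i))) ` {(w, g). matched_pair m r w g}
      \<subseteq> (SIGMA \<pi>:matchings m. barred m r \<pi>)"
    by (auto simp: matched_pair_restrict)
qed simp

text \<open>Two bijections turn barred matchings into multisets of \<open>n\<close> cells, counted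
  by the formula for multisets from \<open>r * (r + 1)\<close> elements.\<close>

lemma sum_J_B:
  assumes "0 < n"
  shows "(\<Sum>k\<le>r. J_B (2 * n) (int k) * ((2 * n + r - k) choose (2 * n)))
    = (r * (r + 1) + n - 1) choose n"
proof -
  have "card (SIGMA \<pi>:matchings (2 * n). barred (2 * n) r \<pi>) = card (multisets_of_size (cells r) n)"
    using bij_betw_same_card[OF bij_betw_odd_ext] bij_betw_same_card[OF bij_betw_cell_mset] by metis
  then show ?thesis
    using assms by (simp add: sum_J_B_eq_card card_multisets_of_size finite_cells card_cells)
qed

section \<open>The recurrence\<close>

lemma J_B_negative: "k < 0 \<Longrightarrow> J_B m k = 0"
  by (auto simp: J_B_def)

text \<open>The term \<open>k = r\<close> has coefficient 1, so the equations can be solved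
  successively.\<close>

lemma triangular_unique:
  fixes f :: "nat \<Rightarrow> int"
  assumes "\<And>r. (\<Sum>k\<le>r. f k * int ((m + r - k) choose m)) = 0"
  shows "f k = 0"
proof (induction k rule: less_induct)
  case (less r)
  have "(\<Sum>k\<le>r. f k * int ((m + r - k) choose m)) = (\<Sum>k\<in>{r}. f k * int ((m + r - k) choose m))"
    by (rule sum.mono_neutral_right) (use less in auto)
  then show ?case
    using assms[of r] by simp
qed

lemma sum_shift:
  fixes h :: "nat \<Rightarrow> 'a::comm_monoid_add"
  assumes "h 0 = 0" "h (Suc r) = 0"
  shows "(\<Sum>k\<le>r. h k) = (\<Sum>k\<le>r. h (Suc k))"
  using assms sum.atMost_Suc[of h r] sum.atMost_Suc_shift[of h r] by simp

text \<open>Applying absorption twice writes each coefficient as a polynomial multiple of the same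
  \<open>(p + M) choose M\<close>; over the integers this includes \<open>p = 0\<close> and
  \<open>p = 1\<close>, where factors vanish.\<close>

lemma binomial_add_2:
  fixes p M :: nat
  defines "B \<equiv> \<lambda>q. int (q choose (M + 2))"
  shows "(int M + 1) * (int M + 2) * B (p + M + 2)
      = (int p + int M + 2) * (int p + int M + 1) * int ((p + M) choose M)"
    and "(int M + 1) * (int M + 2) * B (p + M + 1)
      = (int p + int M + 1) * int p * int ((p + M) choose M)"
    and "(int M + 1) * (int M + 2) * B (p + M)
      = int p * (int p - 1) * int ((p + M) choose M)"
proof -
  have up: "(int k + 1) * int (Suc q choose Suc k) = (int q + 1) * int (q choose k)" for q k
  proof -
    have "int (Suc k * (Suc q choose Suc k)) = int (Suc q * (q choose k))"
      by (simp only: Suc_times_binomial_eq mult.commute)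
    then show ?thesis
      by (simp add: algebra_simps)
  qed
  have right: "(int k + 1) * int (q choose Suc k) = (int q - int k) * int (q choose k)" for q k
    using up[of k q] by (simp add: algebra_simps)
  show "(int M + 1) * (int M + 2) * B (p + M + 2)
      = (int p + int M + 2) * (int p + int M + 1) * int ((p + M) choose M)"
    using up[of "M + 1" "p + M + 1"] up[of M "p + M"] unfolding B_def
    by (simp add: add_ac) (metis mult.assoc mult.left_commute)
  show "(int M + 1) * (int M + 2) * B (p + M + 1)
      = (int p + int M + 1) * int p * int ((p + M) choose M)"
    using up[of "M + 1" "p + M"] right[of M "p + M"] unfolding B_def
    by (simp add: add_ac) (metis mult.assoc mult.left_commute)
  show "(int M + 1) * (int M + 2) * B (p + M)
      = int p * (int p - 1) * int ((p + M) choose M)"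
    using right[of "M + 1" "p + M"] right[of M "p + M"] unfolding B_def
    by (simp add: add_ac) (metis mult.assoc mult.left_commute)
qed

text \<open>With \<open>m = 2 n - 2\<close> and \<open>j + p = r\<close>, multiplication of \<open>t ^ j / (1 - t) ^ (m + 1)\<close> by
  \<open>r * (r + 1) + n - 1\<close> on the coefficient of \<open>t ^ r\<close>, rewritten over \<open>(1 - t) ^ (m + 3)\<close>.\<close>

lemma binomial_recurrence:
  fixes j p n :: nat
  assumes "1 \<le> n"
  shows "((int j + int p) * (int j + int p + 1) + int n - 1) * int ((2 * n - 2 + p) choose (2 * n - 2))
    = (int j ^ 2 + int j + int n - 1) * int ((2 * n + p) choose (2 * n))
      + 2 * (int j * (2 * int n - int j - 2) + int n) * int ((2 * n + p - 1) choose (2 * n))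
      + ((2 * int n - int j - 2) * (2 * int n - int j - 1) + int n - 1)
        * int ((2 * n + p - 2) choose (2 * n))"
    (is "?L = ?R")
proof -
  obtain q where n: "n = Suc q"
    using assms by (cases n) auto
  define M where "M = 2 * q"
  have binomials: "(2 * n - 2 + p) choose (2 * n - 2) = (p + M) choose M"
    "(2 * n + p) choose (2 * n) = (p + M + 2) choose (M + 2)"
    "(2 * n + p - 1) choose (2 * n) = (p + M + 1) choose (M + 2)"
    "(2 * n + p - 2) choose (2 * n) = (p + M) choose (M + 2)"
    by (simp_all add: n M_def add.commute)
  have expand: "(int M + 1) * (int M + 2) * (a * u + b * v + c * w)
      = a * ((int M + 1) * (int M + 2) * u) + b * ((int M + 1) * (int M + 2) * v)
        + c * ((int M + 1) * (int M + 2) * w)" for a b c u v w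
    by (simp add: algebra_simps)
  \<comment> \<open>After this scaling a common binomial coefficient factors out, leaving a
    polynomial identity.\<close>
  have "(int M + 1) * (int M + 2) * ?L = (int M + 1) * (int M + 2) * ?R"
    unfolding binomials expand binomial_add_2 unfolding n M_def
    by (simp add: algebra_simps power2_eq_square)
  moreover have "(int M + 1) * (int M + 2) \<noteq> 0"
    by simp
  ultimately show ?thesis
    by (metis mult_cancel_left)
qed

text \<open>Both sides of the claim satisfy the same triangular system: their weighted sums agree
  for every \<open>r\<close>.\<close>

lemma J_B_recurrence:
  fixes n k :: nat
  assumes n: "2 \<le> n"
  defines "N \<equiv> \<lambda>i. int (J_B (2 * n - 2) i)"
  shows "int n * int (J_B (2 * n) (int k)) =
    ((int k)^2 + int k + int n - 1) * N (int k)
    + 2 * ((int k - 1) * (2 * int n - int k - 1) + int n) * N (int k - 1)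
    + ((2 * int n - int k) * (2 * int n - int k + 1) + (int n - 1)) * N (int k - 2)"
proof -
  define a b c :: "int \<Rightarrow> int" where "a i = i^2 + i + int n - 1"
    and "b i = 2 * ((i - 1) * (2 * int n - i - 1) + int n)"
    and "c i = (2 * int n - i) * (2 * int n - i + 1) + (int n - 1)" for i
  define K where "K k = a (int k) * N (int k) + b (int k) * N (int k - 1) + c (int k) * N (int k - 2)"
    for k
  have N_neg: "N i = 0" if "i < 0" for i
    using that by (simp add: N_def J_B_negative)
  have "(\<Sum>k\<le>r. (int n * int (J_B (2 * n) (int k)) - K k) * int ((2 * n + r - k) choose (2 * n))) = 0"
    for r
  proof -
    let ?C = "\<lambda>k. int ((2 * n + r - k) choose (2 * n))"
    let ?D = "\<lambda>k. int ((2 * n - 2 + r - k) choose (2 * n - 2))"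
    have big: "?C k = 0" if "k > r" for k
      using that n by (auto simp: binomial_eq_0)
    \<comment> \<open>Shifting indices collects everything at \<open>N k\<close>. The lower boundary
      term contains \<open>N\<close> at a negative argument, the upper one a vanishing binomial
      coefficient.\<close>
    have "(\<Sum>k\<le>r. b (int k) * N (int k - 1) * ?C k)
        = (\<Sum>k\<le>r. b (int (Suc k)) * N (int (Suc k) - 1) * ?C (Suc k))"
      by (rule sum_shift) (simp add: N_neg, simp only: big lessI less_SucI mult_zero_right)
    moreover have "(\<Sum>k\<le>r. c (int k) * N (int k - 2) * ?C k)
        = (\<Sum>k\<le>r. c (int (Suc k)) * N (int (Suc k) - 2) * ?C (Suc k))"
      by (rule sum_shift) (simp add: N_neg, simp only: big lessI less_SucI mult_zero_right)
    moreover have "\<dots> = (\<Sum>k\<le>r. c (int (Suc (Suc k))) * N (int (Suc (Suc k)) - 2) * ?C (Suc (Suc k)))"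
      by (rule sum_shift) (simp add: N_neg, simp only: big lessI less_SucI mult_zero_right)
    ultimately have "(\<Sum>k\<le>r. K k * ?C k) = (\<Sum>k\<le>r. a (int k) * N (int k) * ?C k)
        + (\<Sum>k\<le>r. b (int (Suc k)) * N (int (Suc k) - 1) * ?C (Suc k))
        + (\<Sum>k\<le>r. c (int (Suc (Suc k))) * N (int (Suc (Suc k)) - 2) * ?C (Suc (Suc k)))"
      by (simp only: K_def distrib_right sum.distrib)
    also have "\<dots> = (\<Sum>k\<le>r. (a (int k) * ?C k
        + b (int k + 1) * ?C (Suc k) + c (int k + 2) * ?C (Suc (Suc k))) * N (int k))"
      unfolding sum.distrib[symmetric] by (rule sum.cong) (simp_all add: algebra_simps)
    also have "\<dots> = (\<Sum>k\<le>r. (int r * (int r + 1) + int n - 1) * (N (int k) * ?D k))"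
    proof (rule sum.cong)
      fix k assume "k \<in> {..r}"
      then have r: "int r = int k + int (r - k)" and
        idx: "2 * n + r - k = 2 * n + (r - k)" "2 * n + r - Suc k = 2 * n + (r - k) - 1"
        "2 * n + r - Suc (Suc k) = 2 * n + (r - k) - 2" "2 * n - 2 + r - k = 2 * n - 2 + (r - k)"
        using n by auto
      have "a (int k) * ?C k + b (int k + 1) * ?C (Suc k) + c (int k + 2) * ?C (Suc (Suc k))
          = (int r * (int r + 1) + int n - 1) * ?D k"
        unfolding idx r using n
        by (subst binomial_recurrence) (simp_all add: a_def b_def c_def algebra_simps)
      then show "(a (int k) * ?C k + b (int k + 1) * ?C (Suc k) + c (int k + 2) * ?C (Suc (Suc k)))
          * N (int k) = (int r * (int r + 1) + int n - 1) * (N (int k) * ?D k)"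
        by (simp only: mult_ac)
    qed simp
    also have "\<dots> = (int r * (int r + 1) + int n - 1)
        * int (\<Sum>k\<le>r. J_B (2 * (n - 1)) (int k) * ((2 * (n - 1) + r - k) choose (2 * (n - 1))))"
      by (simp add: sum_distrib_left N_def diff_mult_distrib2)
    also have "\<dots> = int ((r * (r + 1) + n - 1) * ((r * (r + 1) + n - 1 - 1) choose (n - 1)))"
    proof -
      have coeff: "int r * (int r + 1) + int n - 1 = int (r * (r + 1) + n - 1)"
        using n by (simp add: of_nat_diff algebra_simps)
      have index: "r * (r + 1) + (n - 1) - 1 = r * (r + 1) + n - 1 - 1"
        using n by simp
      have total: "(\<Sum>k\<le>r. J_B (2 * (n - 1)) (int k) * ((2 * (n - 1) + r - k) choose (2 * (n - 1))))
          = (r * (r + 1) + (n - 1) - 1) choose (n - 1)"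
        by (rule sum_J_B) (use n in simp)
      show ?thesis
        unfolding total coeff index by (rule of_nat_mult[symmetric])
    qed
    \<comment> \<open>Absorption for binomial coefficients turns the count for \<open>n - 1\<close>
      into \<open>n\<close> times the count for \<open>n\<close>.\<close>
    also have "\<dots> = int (n * ((r * (r + 1) + n - 1) choose n))"
      using n by (subst times_binomial_minus1_eq) simp_all
    also have "\<dots> = int n * (\<Sum>k\<le>r. int (J_B (2 * n) (int k)) * ?C k)"
      using n by (subst sum_J_B[symmetric]) simp_all
    finally show ?thesis
      by (simp add: left_diff_distrib sum_subtractf sum_distrib_left mult.assoc)
  qed
  from triangular_unique[OF this] show ?thesis
    by (simp add: K_def a_def b_def c_def)
qed

theorem theorem1p7:
  shows "J_B 2 0 = 0 \<and> J_B 2 1 = 2 \<and> J_B 2 2 = 0 \<and>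
    (\<forall>(n::nat) (k::int). n \<ge> 2 \<longrightarrow> k \<ge> 0 \<longrightarrow>
      int n * int (J_B (2 * n) k) =
        (k^2 + k + int n - 1) * int (J_B (2 * n - 2) k)
        + 2 * ((k - 1) * (2 * int n - k - 1) + int n) * int (J_B (2 * n - 2) (k - 1))
        + ((2 * int n - k) * (2 * int n - k + 1) + (int n - 1)) * int (J_B (2 * n - 2) (k - 2)))"
proof -
  \<comment> \<open>For \<open>n = 1\<close> the right-hand side of \<open>sum_J_B\<close> is
    \<open>r * (r + 1)\<close>; the equations at \<open>r = 0, 1, 2\<close> give the three values in
    turn.\<close>
  have "J_B 2 0 = 0"
    using sum_J_B[of 1 0] by simp
  moreover from this have "J_B 2 1 = 2"
    using sum_J_B[of 1 1] by (simp add: numeral_2_eq_2)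
  moreover from calculation have "J_B 2 2 = 0"
    using sum_J_B[of 1 2] by (simp add: numeral_eq_Suc)
  moreover have "int n * int (J_B (2 * n) k) =
        (k^2 + k + int n - 1) * int (J_B (2 * n - 2) k)
        + 2 * ((k - 1) * (2 * int n - k - 1) + int n) * int (J_B (2 * n - 2) (k - 1))
        + ((2 * int n - k) * (2 * int n - k + 1) + (int n - 1)) * int (J_B (2 * n - 2) (k - 2))"
    if "n \<ge> 2" "k \<ge> 0" for n :: nat and k :: int
    using J_B_recurrence[OF that(1), of "nat k"] that(2) by simp
  ultimately show ?thesis
    by blast
qed

end
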